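(* For the matrix deletion channel with deletion probability $p$ and $q=1-p$, $\exp\big(O(n^{1/4}\sqrt{p\log n}/q)\big)$ traces suffice to recover an arbitrary matrix $X\in\{0,1\}^{\sqrt n\times\sqrt n}$ with high probability.
   Context: The matrix deletion channel with deletion probability $p$ takes $X\in\{0,1\}^{\sqrt n\times\sqrt n}$ and deletes each row and each column independently with probability $p$, outputting the submatrix formed by the surviving rows and columns (in their original relative order, without revealing which were deleted); each output is a matrix trace. "With high probability" means with probability at least $1-o(1)$ as $n\to\infty$. *)

theory Defs
  imports "HOL-Probability.Probability" "Jordan_Normal_Form.DL_Submatrix"
begin

text \<open>The index set of the surviving lines (rows or columns) among \<open>k\<close> lines, each line being
  deleted independently with probability \<open>p\<close>.\<close>

definition survivors :: "real \<Rightarrow> nat \<Rightarrow> nat set pmf" where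
  "survivors p k =
     map_pmf (\<lambda>s. {i. i < k \<and> s i}) (Pi_pmf {..<k} False (\<lambda>_. bernoulli_pmf (1 - p)))"

text \<open>The law of a single trace of \<open>X\<close>. Only the submatrix is output, not the index sets \<open>R\<close> and
  \<open>S\<close>; \<^const>\<open>submatrix\<close> keeps the selected rows and columns in increasing order of their
  indices.\<close>

definition matrix_deletion_channel :: "real \<Rightarrow> 'a mat \<Rightarrow> 'a mat pmf" where
  "matrix_deletion_channel p X =
     bind_pmf (survivors p (dim_row X)) (\<lambda>R.
     bind_pmf (survivors p (dim_col X)) (\<lambda>S.
     return_pmf (submatrix X R S)))"

definition matrix_traces :: "nat \<Rightarrow> real \<Rightarrow> 'a mat \<Rightarrow> 'a mat list pmf" where
  "matrix_traces T p X = replicate_pmf T (matrix_deletion_channel p X)"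

end

theory Submission
  imports Defs "HOL-Complex_Analysis.Complex_Analysis" "HOL-Real_Asymp.Real_Asymp"
begin

text \<open>If \<open>m\<close> is the side length and \<open>m p < ln m\<close>, the allowed number of traces is large enough that some
  trace has full size, and such a trace is the matrix itself.

  Otherwise estimate, for every position \<open>(i, j)\<close>, the probability that a trace has a \<open>1\<close> there. As
  these are only \<open>m\<^sup>2\<close> numbers, it is enough that for \<open>X \<noteq> Y\<close> one of them differs by a margin \<open>\<eta>\<close>. Their
  generating function at \<open>(w, w')\<close> is \<open>q\<^sup>2\<close> times the polynomial with coefficients \<open>X\<^sub>r\<^sub>s\<close> at
  \<open>(p + q w, p + q w')\<close>. On the arc of half-angle \<open>\<pi> / L\<close> around \<open>1\<close> the polynomial with coefficients
  in \<open>{-1, 0, 1}\<close> reaches \<open>m\<close> to the power \<open>-2 L\<^sup>2\<close>: apply the maximum principle to the product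
  of \<open>L\<close> rotated copies, once in each variable. The corresponding \<open>w\<close> have modulus at most
  \<open>exp (p (\<pi> / L)\<^sup>2 / (2 q\<^sup>2))\<close>, and balancing the two effects gives
  \<open>L\<^sup>2 \<approx> sqrt (m p / ln m) / q\<close>.\<close>

section \<open>Polynomials on an arc of the unit circle\<close>

text \<open>Measured in steps of \<open>2 * pi / L\<close>, rounding the argument of
  \<open>z\<close> to the nearest integer leaves at most half a step. The number of steps to rotate
  back matters only modulo \<open>L\<close>, which gives the index \<open>j\<close>.\<close>

lemma unit_circle_rotate_to_arc:
  fixes z :: complex
  assumes L: "L > 0" and z: "norm z = 1"
  shows "\<exists>j<L. \<exists>\<theta>. \<bar>\<theta>\<bar> \<le> pi / real L \<and> z * cis (2 * pi * real j / real L) = cis \<theta>"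
proof -
  define t where "t = Arg z * real L / (2 * pi)"
  define k where "k = round t"
  define j where "j = nat ((- k) mod int L)"
  define d where "d = (- k) div int L"
  define \<theta> where "\<theta> = (t - of_int k) * (2 * pi / real L)"
  have j: "j < L" "int j = (- k) mod int L"
    using L by (auto simp: j_def nat_less_iff)
  have "- k = d * int L + int j"
    unfolding j(2) d_def by simp
  hence "real_of_int (- k) = real_of_int (d * int L + int j)"
    by simp
  hence k: "real j = - of_int k - of_int d * real L"
    by simp
  have "\<bar>t - of_int k\<bar> \<le> 1 / 2"
    using of_int_round_abs_le[of t] by (simp add: k_def abs_minus_commute)
  hence "\<bar>t - of_int k\<bar> * (2 * pi / real L) \<le> 1 / 2 * (2 * pi / real L)"
    by (rule mult_right_mono) simp
  moreover have "\<bar>2 * pi / real L\<bar> = 2 * pi / real L"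
    by simp
  ultimately have \<theta>: "\<bar>\<theta>\<bar> \<le> pi / real L"
    unfolding \<theta>_def abs_mult by simp
  have "z \<noteq> 0" using z by auto
  hence "z = cis (Arg z)"
    using cis_Arg[of z] z by (simp add: sgn_eq)
  hence "z * cis (2 * pi * real j / real L) = cis (Arg z + 2 * pi * real j / real L)"
    by (metis cis_mult)
  also have "Arg z = t * (2 * pi / real L)"
    using L by (simp add: t_def)
  also have "t * (2 * pi / real L) + 2 * pi * real j / real L = \<theta> - 2 * pi * of_int d"
    unfolding k \<theta>_def using L by (simp add: field_simps)
  also have "cis \<dots> = cis \<theta>"
    by (simp flip: cis_divide)
  finally show ?thesis
    using j(1) \<theta> by blast
qed

text \<open>The product of the \<open>L\<close> rotations of \<open>f\<close> has a factor evaluated on the arc at every point of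
  the unit circle, and its value at \<open>0\<close> is at most its maximum on the circle.\<close>

lemma norm_at_0_le_arc:
  assumes hol: "f holomorphic_on UNIV" and L: "L > 0"
    and arc: "\<And>\<theta>. \<bar>\<theta>\<bar> \<le> pi / real L \<Longrightarrow> norm (f (cis \<theta>)) \<le> \<beta>"
    and circle: "\<And>z. norm z = 1 \<Longrightarrow> norm (f z) \<le> K"
  shows "norm (f 0) ^ L \<le> \<beta> * K ^ (L - 1)"
proof -
  define F where "F = (\<lambda>z. \<Prod>j<L. f (z * cis (2 * pi * real j / real L)))"
  have rot: "(\<lambda>z. f (z * c)) holomorphic_on A" for c A
  proof -
    have "(\<lambda>z. z * c) holomorphic_on A" by (intro holomorphic_intros)
    from holomorphic_on_compose_gen[OF this hol] show ?thesis by (simp add: o_def)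
  qed
  have hol': "F holomorphic_on A" for A
    unfolding F_def by (intro holomorphic_on_prod rot)
  have K0: "0 \<le> K"
    by (rule order_trans[OF norm_ge_zero circle[of 1]]) simp
  have F_le: "norm (F z) \<le> \<beta> * K ^ (L - 1)" if z: "norm z = 1" for z
  proof -
    obtain k \<theta> where k: "k < L" "\<bar>\<theta>\<bar> \<le> pi / real L" "z * cis (2 * pi * real k / real L) = cis \<theta>"
      using unit_circle_rotate_to_arc[OF L z] by blast
    have "norm (F z) = norm (f (z * cis (2 * pi * real k / real L))) *
            (\<Prod>j\<in>{..<L}-{k}. norm (f (z * cis (2 * pi * real j / real L))))"
      unfolding F_def prod_norm[symmetric] using k(1) by (subst prod.remove[of _ k]) auto
    also have "\<dots> \<le> \<beta> * (\<Prod>j\<in>{..<L}-{k}. K)"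
      using arc[OF k(2)] circle z
      by (intro mult_mono prod_mono) (auto simp: k(3) norm_mult prod_nonneg intro: order_trans[OF norm_ge_zero])
    finally show ?thesis using k(1) by simp
  qed
  have "norm (F 0) \<le> \<beta> * K ^ (L - 1)"
    by (rule maximum_modulus_frontier[where S = "cball 0 1"])
       (use F_le in \<open>auto intro!: hol' holomorphic_on_imp_continuous_on\<close>)
  thus ?thesis by (simp add: F_def norm_power)
qed

text \<open>Dividing by \<open>z ^ k\<close> moves \<open>a k\<close> to the value at
  \<open>0\<close> without changing moduli on the unit circle, so \<open>norm_at_0_le_arc\<close>
  applies with \<open>K = m * A\<close>.\<close>

lemma polynomial_leading_coeff_le_arc:
  fixes a :: "nat \<Rightarrow> complex"
  assumes L: "L > 0" and k: "k < m" and zero: "\<And>j. j < k \<Longrightarrow> a j = 0"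
    and A: "\<And>j. j < m \<Longrightarrow> norm (a j) \<le> A"
    and arc: "\<And>\<theta>. \<bar>\<theta>\<bar> \<le> pi / real L \<Longrightarrow> norm (\<Sum>j<m. a j * cis \<theta> ^ j) \<le> \<beta>"
  shows "norm (a k) ^ L \<le> \<beta> * (real m * A) ^ (L - 1)"
proof -
  define h where "h = (\<lambda>z. \<Sum>j\<in>{k..<m}. a j * z ^ (j - k))"
  have factor: "(\<Sum>j<m. a j * z ^ j) = z ^ k * h z" for z
  proof -
    have "(\<Sum>j<m. a j * z ^ j) = (\<Sum>j\<in>{k..<m}. a j * z ^ j)"
      using zero by (intro sum.mono_neutral_right) auto
    also have "\<dots> = (\<Sum>j\<in>{k..<m}. z ^ k * (a j * z ^ (j - k)))"
      by (intro sum.cong refl) (auto simp flip: power_add simp: mult.left_commute)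
    finally show ?thesis by (simp add: h_def sum_distrib_left)
  qed
  have A0: "0 \<le> A" using A[OF k] norm_ge_zero order_trans by blast
  have "norm (h 0) ^ L \<le> \<beta> * (real m * A) ^ (L - 1)"
  proof (rule norm_at_0_le_arc[OF _ L])
    show "h holomorphic_on UNIV"
      unfolding h_def by (intro holomorphic_intros)
    show "norm (h (cis \<theta>)) \<le> \<beta>" if "\<bar>\<theta>\<bar> \<le> pi / real L" for \<theta>
      using arc[OF that] unfolding factor by (simp add: norm_mult norm_power)
    show "norm (h z) \<le> real m * A" if "norm z = 1" for z
    proof -
      have "norm (h z) \<le> (\<Sum>j\<in>{k..<m}. A)"
        unfolding h_def using that A by (intro sum_norm_le) (auto simp: norm_mult norm_power)
      also have "\<dots> \<le> real m * A"
        using A0 by (simp add: mult_right_mono)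
      finally show ?thesis .
    qed
  qed
  also have "h 0 = (\<Sum>j\<in>{k..<m}. if j = k then a j else 0)"
    unfolding h_def by (intro sum.cong) auto
  also have "\<dots> = a k" using k by simp
  finally show ?thesis .
qed

text \<open>The univariate bound is applied once per variable to the lexicographically first nonzero
  coefficient \<open>d r0 s0\<close>, which has modulus 1: first in \<open>\<theta>\<close> with
  \<open>\<phi>\<close> fixed, then in \<open>\<phi>\<close>.\<close>

lemma bivariate_littlewood_arc:
  fixes d :: "nat \<Rightarrow> nat \<Rightarrow> complex"
  assumes L: "L > 0"
    and nz: "\<exists>r<m. \<exists>s<m. d r s \<noteq> 0"
    and d: "\<And>r s. r < m \<Longrightarrow> s < m \<Longrightarrow> d r s \<noteq> 0 \<Longrightarrow> norm (d r s) = 1"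
    and arc: "\<And>\<theta> \<phi>. \<bar>\<theta>\<bar> \<le> pi / real L \<Longrightarrow> \<bar>\<phi>\<bar> \<le> pi / real L \<Longrightarrow>
      norm (\<Sum>r<m. \<Sum>s<m. d r s * cis \<theta> ^ r * cis \<phi> ^ s) \<le> \<beta>"
  shows "1 \<le> \<beta> * real m ^ (2 * L\<^sup>2)"
proof -
  have m: "m \<ge> 1" using nz by auto
  have d_le: "norm (d r s) \<le> 1" if "r < m" "s < m" for r s
    using d[OF that] by (cases "d r s = 0") auto
  define r0 where "r0 = (LEAST r. r < m \<and> (\<exists>s<m. d r s \<noteq> 0))"
  have r0: "r0 < m" "\<exists>s<m. d r0 s \<noteq> 0"
    unfolding r0_def by (rule LeastI2_ex; use nz in blast)+
  have r0_min: "d r s = 0" if "r < r0" "s < m" for r s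
    using not_less_Least[OF that(1)[unfolded r0_def]] that r0(1) by auto
  define s0 where "s0 = (LEAST s. s < m \<and> d r0 s \<noteq> 0)"
  have s0: "s0 < m" "d r0 s0 \<noteq> 0"
    unfolding s0_def by (rule LeastI2_ex; use r0(2) in blast)+
  have s0_min: "d r0 s = 0" if "s < s0" for s
    using not_less_Least[OF that[unfolded s0_def]] that s0(1) by auto
  have "norm (\<Sum>r<m. \<Sum>s<m. d r s * cis 0 ^ r * cis 0 ^ s) \<le> \<beta>"
    by (rule arc) auto
  hence \<beta>0: "\<beta> \<ge> 0"
    using norm_ge_zero order_trans by blast
  define \<gamma> where "\<gamma> = \<beta> * (real m * real m) ^ (L - 1)"
  have \<gamma>0: "\<gamma> \<ge> 0" unfolding \<gamma>_def using \<beta>0 by simp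
  \<comment> \<open>For fixed \<open>\<phi>\<close> the inner sums are the coefficients of a
    polynomial in \<open>cis \<theta>\<close>, each of modulus at most \<open>m\<close>; hence the
    base \<open>m * m\<close> in \<open>\<gamma>\<close>. Taking the \<open>L\<close>-th root makes
    the estimate an arc bound for the second application.\<close>
  have row: "norm (\<Sum>s<m. d r0 s * cis \<phi> ^ s) \<le> root L \<gamma>" if \<phi>: "\<bar>\<phi>\<bar> \<le> pi / real L" for \<phi>
  proof -
    have "norm (\<Sum>s<m. d r0 s * cis \<phi> ^ s) ^ L \<le> \<beta> * (real m * real m) ^ (L - 1)"
    proof (rule polynomial_leading_coeff_le_arc[where a = "\<lambda>r. \<Sum>s<m. d r s * cis \<phi> ^ s", OF L r0(1)])
      show "(\<Sum>s<m. d r s * cis \<phi> ^ s) = 0" if "r < r0" for r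
        using r0_min[OF that] by simp
      show "norm (\<Sum>s<m. d r s * cis \<phi> ^ s) \<le> real m" if "r < m" for r
      proof -
        have "norm (\<Sum>s<m. d r s * cis \<phi> ^ s) \<le> (\<Sum>s<m. 1)"
          using d_le[OF that] by (intro sum_norm_le) (auto simp: norm_mult norm_power)
        thus ?thesis by simp
      qed
      show "norm (\<Sum>r<m. (\<Sum>s<m. d r s * cis \<phi> ^ s) * cis \<theta> ^ r) \<le> \<beta>" if "\<bar>\<theta>\<bar> \<le> pi / real L" for \<theta>
        using arc[OF that \<phi>] by (simp add: sum_distrib_right mult.assoc mult.commute[of "cis \<phi> ^ _"])
    qed
    hence "root L (norm (\<Sum>s<m. d r0 s * cis \<phi> ^ s) ^ L) \<le> root L \<gamma>"
      unfolding \<gamma>_def using L by (simp only: real_root_le_iff)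
    thus ?thesis
      using L by (simp add: real_root_power_cancel)
  qed
  have "norm (d r0 s0) ^ L \<le> root L \<gamma> * (real m * 1) ^ (L - 1)"
    by (rule polynomial_leading_coeff_le_arc[OF L s0(1)])
       (use s0_min d_le[OF r0(1)] row in auto)
  hence "1 \<le> root L \<gamma> * real m ^ (L - 1)"
    using d[OF r0(1) s0] by simp
  \<comment> \<open>The \<open>L\<close>-th power removes the root. The exponent of \<open>m\<close>
    is then \<open>2 * (L - 1)\<close> from \<open>\<gamma>\<close> plus \<open>(L - 1) * L\<close>
    from the second variable.\<close>
  hence "1 \<le> (root L \<gamma> * real m ^ (L - 1)) ^ L"
    by (rule one_le_power)
  also have "\<dots> = \<beta> * real m ^ (2 * (L - 1) + (L - 1) * L)"
    using L \<gamma>0 by (simp add: power_mult_distrib \<gamma>_def power_add power_mult power2_eq_square)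
  also have "\<dots> \<le> \<beta> * real m ^ (2 * L\<^sup>2)"
  proof (intro mult_left_mono power_increasing)
    obtain k where k: "L = Suc k" using L by (cases L) auto
    show "2 * (L - 1) + (L - 1) * L \<le> 2 * L\<^sup>2"
      by (simp add: k power2_eq_square algebra_simps)
  qed (use m \<beta>0 in auto)
  finally show ?thesis .
qed

section \<open>The law of a trace\<close>

lemma prob_pair_pmf_Times:
  "measure_pmf.prob (pair_pmf M N) (A \<times> B) = measure_pmf.prob M A * measure_pmf.prob N B"
proof -
  have "measure_pmf.prob (pair_pmf M N) (A \<times> B) =
      pmf (map_pmf (\<lambda>(x, y). (x \<in> A, y \<in> B)) (pair_pmf M N)) (True, True)"
    by (auto simp: pmf_map vimage_def intro!: arg_cong[where f = "measure_pmf.prob _"])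
  also have "\<dots> = pmf (pair_pmf (map_pmf (\<lambda>x. x \<in> A) M) (map_pmf (\<lambda>y. y \<in> B) N)) (True, True)"
    by (subst map_pair) simp
  finally show ?thesis
    by (simp add: pmf_pair pmf_map vimage_def)
qed

section \<open>Surviving lines: sizes, ranks and their generating functions\<close>

lemma survivors_0: "survivors p 0 = return_pmf {}"
  by (simp add: survivors_def)

text \<open>The highest index is decided separately because its survival leaves the ranks of all
  lower lines unchanged; the inductions on \<open>k\<close> rest on this.\<close>

lemma survivors_Suc:
  "survivors p (Suc k) =
     bind_pmf (bernoulli_pmf (1 - p)) (\<lambda>b. map_pmf (\<lambda>R. if b then insert k R else R) (survivors p k))"
  unfolding survivors_def lessThan_Suc
  by (subst Pi_pmf_insert')
     (auto simp: map_pmf_def bind_assoc_pmf bind_return_pmf less_Suc_eq split: if_splits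
           intro!: bind_pmf_cong arg_cong[where f = return_pmf])

lemma set_pmf_survivors: "set_pmf (survivors p k) \<subseteq> Pow {..<k}"
  by (auto simp: survivors_def)

lemma finite_set_pmf_survivors: "finite (set_pmf (survivors p k))"
  using finite_subset[OF set_pmf_survivors] by simp

lemma expectation_survivors_Suc:
  fixes f :: "nat set \<Rightarrow> 'a :: {banach, second_countable_topology}"
  assumes "0 \<le> p" "p \<le> 1"
  shows "measure_pmf.expectation (survivors p (Suc k)) f =
     (1 - p) *\<^sub>R measure_pmf.expectation (survivors p k) (\<lambda>R. f (insert k R)) +
     p *\<^sub>R measure_pmf.expectation (survivors p k) f"
  unfolding survivors_Suc using assms
  by (subst pmf_expectation_bind[of UNIV]) (auto simp: UNIV_bool finite_set_pmf_survivors)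

lemma expectation_survivors_card:
  fixes w :: complex
  assumes "0 \<le> p" "p \<le> 1"
  shows "measure_pmf.expectation (survivors p k) (\<lambda>R. w ^ card R) = (of_real p + of_real (1 - p) * w) ^ k"
proof (induction k)
  case (Suc k)
  have "measure_pmf.expectation (survivors p k) (\<lambda>R. w ^ card (insert k R)) =
        measure_pmf.expectation (survivors p k) (\<lambda>R. w * w ^ card R)"
  proof (intro integral_cong_AE AE_pmfI)
    fix R assume "R \<in> set_pmf (survivors p k)"
    hence "R \<subseteq> {..<k}" using set_pmf_survivors by blast
    hence "finite R" "k \<notin> R" using finite_subset by auto
    thus "w ^ card (insert k R) = w * w ^ card R" by simp
  qed auto
  thus ?case
    using Suc by (simp add: expectation_survivors_Suc assms scaleR_conv_of_real algebra_simps)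
qed (simp add: survivors_0)

text \<open>The rank of a surviving line \<open>r\<close> counts the survivors among the
  \<open>r\<close> lines before it, which are independent of the fate of \<open>r\<close>. In the
  induction, adding line \<open>r\<close> itself reduces to
  \<open>expectation_survivors_card\<close>, and later lines change nothing.\<close>

lemma expectation_survivors_rank:
  fixes w :: complex
  assumes "0 \<le> p" "p \<le> 1" and "r < k"
  shows "measure_pmf.expectation (survivors p k) (\<lambda>R. of_bool (r \<in> R) * w ^ card {a\<in>R. a < r}) =
           of_real (1 - p) * (of_real p + of_real (1 - p) * w) ^ r"
  using \<open>r < k\<close>
proof (induction k)
  case (Suc k)
  let ?f = "\<lambda>R. of_bool (r \<in> R) * w ^ card {a\<in>R. a < r} :: complex"
  show ?case
  proof (cases "r = k")
    case True
    have 1: "measure_pmf.expectation (survivors p k) (\<lambda>R. ?f (insert k R)) =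
          measure_pmf.expectation (survivors p k) (\<lambda>R. w ^ card R)"
    proof (intro integral_cong_AE AE_pmfI)
      fix R assume "R \<in> set_pmf (survivors p k)"
      hence "R \<subseteq> {..<k}" using set_pmf_survivors by blast
      hence "{a \<in> insert k R. a < k} = R" by auto
      thus "?f (insert k R) = w ^ card R" by (simp add: True)
    qed auto
    have "measure_pmf.expectation (survivors p k) ?f = measure_pmf.expectation (survivors p k) (\<lambda>R. 0)"
    proof (intro integral_cong_AE AE_pmfI)
      fix R assume "R \<in> set_pmf (survivors p k)"
      hence "R \<subseteq> {..<k}" using set_pmf_survivors by blast
      thus "?f R = 0" by (auto simp: True)
    qed auto
    with 1 show ?thesis
      using True by (simp add: expectation_survivors_Suc assms scaleR_conv_of_real expectation_survivors_card)
  next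
    case False
    hence r: "r < k" using Suc.prems by simp
    have "{a \<in> insert k R. a < r} = {a\<in>R. a < r}" for R using r by auto
    hence "?f (insert k R) = ?f R" for R using r by simp
    thus ?thesis
      using Suc.IH[OF r] by (simp only: expectation_survivors_Suc assms(1,2)) (simp add: scaleR_conv_of_real algebra_simps)
  qed
qed simp

text \<open>This is the substochastic transition matrix of the channel in one dimension. The guard
  discards positions past the end of the trace, where \<open>pick\<close> carries no
  information.\<close>

definition line_prob :: "real \<Rightarrow> nat \<Rightarrow> nat \<Rightarrow> nat \<Rightarrow> real" where
  "line_prob p k i r = measure_pmf.prob (survivors p k) {R. i < card R \<and> pick R i = r}"

text \<open>A surviving line occupies exactly one position, namely the number of survivors below it,
  and this is less than \<open>k\<close>; so at most one term of the sum remains.\<close>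

lemma sum_pick_eq_rank:
  fixes w :: "'a :: comm_ring_1"
  assumes "R \<subseteq> {..<k}"
  shows "(\<Sum>i<k. of_bool (i < card R \<and> pick R i = r) * w ^ i) = of_bool (r \<in> R) * w ^ card {a\<in>R. a < r}"
proof -
  have fin: "finite R" using assms finite_subset by blast
  have R: "card R \<le> k" using card_mono[OF _ assms] by simp
  show ?thesis
  proof (cases "r \<in> R")
    case True
    have "{a\<in>R. a < r} \<subset> R" using True by auto
    hence lt: "card {a\<in>R. a < r} < card R" using fin by (simp add: psubset_card_mono)
    have iff: "i < card R \<and> pick R i = r \<longleftrightarrow> i = card {a\<in>R. a < r}" for i
      using lt pick_card_in_set[OF True] card_pick_le[of i R] by auto
    show ?thesis
      unfolding iff using True lt R by (simp add: of_bool_def if_distrib[of "\<lambda>x. x * _"] cong: if_cong)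
  next
    case False
    hence "\<not> (i < card R \<and> pick R i = r)" for i
      using pick_in_set_le[of i R] by auto
    thus ?thesis using False by (simp only: of_bool_eq) simp
  qed
qed

text \<open>On generating functions the channel acts in one dimension, up to the factor
  \<open>1 - p\<close>, as the affine substitution of \<open>p + (1 - p) * w\<close> for the
  variable. Exchanging sum and expectation reduces this to the rank formula.\<close>

lemma line_prob_generating_function:
  fixes w :: complex
  assumes "0 \<le> p" "p \<le> 1" and "r < k"
  shows "(\<Sum>i<k. of_real (line_prob p k i r) * w ^ i) = of_real (1 - p) * (of_real p + of_real (1 - p) * w) ^ r"
proof -
  let ?S = "survivors p k"
  have int: "integrable (measure_pmf ?S) f" for f :: "nat set \<Rightarrow> complex"
    by (rule integrable_measure_pmf_finite[OF finite_set_pmf_survivors])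
  have "of_real (line_prob p k i r) = 
        measure_pmf.expectation ?S (\<lambda>R. of_bool (i < card R \<and> pick R i = r) :: complex)" for i
  proof -
    have "line_prob p k i r = measure_pmf.expectation ?S (\<lambda>R. indicator {R. i < card R \<and> pick R i = r} R)"
      by (simp add: line_prob_def)
    also have "complex_of_real \<dots> = measure_pmf.expectation ?S (\<lambda>R. of_bool (i < card R \<and> pick R i = r))"
      unfolding integral_complex_of_real[symmetric]
      by (intro Bochner_Integration.integral_cong) (auto simp: indicator_def)
    finally show ?thesis .
  qed
  hence "(\<Sum>i<k. of_real (line_prob p k i r) * w ^ i) =
     (\<Sum>i<k. measure_pmf.expectation ?S (\<lambda>R. of_bool (i < card R \<and> pick R i = r) * w ^ i))"
    by (simp only: integral_mult_left_zero)
  also have "\<dots> = measure_pmf.expectation ?S (\<lambda>R. \<Sum>i<k. of_bool (i < card R \<and> pick R i = r) * w ^ i)"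
    by (rule Bochner_Integration.integral_sum[symmetric]) (rule int)
  also have "\<dots> = measure_pmf.expectation ?S (\<lambda>R. of_bool (r \<in> R) * w ^ card {a\<in>R. a < r})"
    by (intro integral_cong_AE AE_pmfI sum_pick_eq_rank) (use set_pmf_survivors in auto)
  finally show ?thesis
    by (simp add: expectation_survivors_rank assms)
qed

section \<open>Entry probabilities and their bivariate generating function\<close>

definition entry_prob :: "real \<Rightarrow> bool mat \<Rightarrow> nat \<Rightarrow> nat \<Rightarrow> real" where
  "entry_prob p X i j =
     measure_pmf.prob (matrix_deletion_channel p X) {Z. i < dim_row Z \<and> j < dim_col Z \<and> Z $$ (i, j)}"

lemma matrix_deletion_channel_altdef:
  "matrix_deletion_channel p X =
     map_pmf (\<lambda>(R, S). submatrix X R S) (pair_pmf (survivors p (dim_row X)) (survivors p (dim_col X)))"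
  unfolding matrix_deletion_channel_def pair_pmf_def map_pmf_def
  by (simp add: bind_assoc_pmf bind_return_pmf)

text \<open>The event is split according to the cell \<open>(r, s)\<close> of \<open>X\<close> that
  lands at \<open>(i, j)\<close>. The pieces are disjoint, and row and column deletions are
  independent.\<close>

lemma entry_prob_conv_line_prob:
  assumes X: "X \<in> carrier_mat m m"
  shows "entry_prob p X i j =
    (\<Sum>r<m. \<Sum>s<m. of_bool (X $$ (r, s)) * (line_prob p m i r * line_prob p m j s))"
proof -
  let ?M = "pair_pmf (survivors p m) (survivors p m)"
  let ?I = "{rs \<in> {..<m} \<times> {..<m}. X $$ rs}"
  let ?E = "\<lambda>i r. {R. i < card R \<and> pick R i = r}"
  have dims: "dim_row X = m" "dim_col X = m" using X by auto
  have "entry_prob p X i j = measure_pmf.prob ?M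
     {(R, S). i < dim_row (submatrix X R S) \<and> j < dim_col (submatrix X R S) \<and> submatrix X R S $$ (i, j)}"
    by (simp add: entry_prob_def matrix_deletion_channel_altdef dims vimage_def case_prod_unfold)
  also have "\<dots> = measure_pmf.prob ?M (\<Union>rs\<in>?I. ?E i (fst rs) \<times> ?E j (snd rs))"
  proof (intro measure_pmf.finite_measure_eq_AE AE_pmfI)
    fix RS assume "RS \<in> set_pmf ?M"
    then obtain R S where RS: "RS = (R, S)" "R \<subseteq> {..<m}" "S \<subseteq> {..<m}"
      using set_pmf_survivors by (cases RS) fastforce
    have eq: "{i. i < m \<and> i \<in> R} = R" "{i. i < m \<and> i \<in> S} = S" using RS by auto
    have lt: "i < card R \<Longrightarrow> pick R i < m" "j < card S \<Longrightarrow> pick S j < m"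
      using pick_in_set_le RS by blast+
    show "RS \<in> {(R, S). i < dim_row (submatrix X R S) \<and> j < dim_col (submatrix X R S) \<and> submatrix X R S $$ (i, j)} \<longleftrightarrow>
       RS \<in> (\<Union>rs\<in>?I. ?E i (fst rs) \<times> ?E j (snd rs))"
      using lt by (auto simp: RS(1) submatrix_def dims eq)
  qed auto
  also have "\<dots> = (\<Sum>rs\<in>?I. measure_pmf.prob ?M (?E i (fst rs) \<times> ?E j (snd rs)))"
    by (rule measure_pmf.finite_measure_finite_Union) (auto simp: disjoint_family_on_def)
  also have "\<dots> = (\<Sum>rs\<in>?I. line_prob p m i (fst rs) * line_prob p m j (snd rs))"
    unfolding line_prob_def
    by (simp only: prob_pair_pmf_Times)
  also have "\<dots> = (\<Sum>rs\<in>{..<m} \<times> {..<m}. of_bool (X $$ rs) * (line_prob p m i (fst rs) * line_prob p m j (snd rs)))"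
    by (intro sum.mono_neutral_cong_left) auto
  also have "\<dots> = (\<Sum>r<m. \<Sum>s<m. of_bool (X $$ (r, s)) * (line_prob p m i r * line_prob p m j s))"
    unfolding sum.cartesian_product by (intro sum.cong) auto
  finally show ?thesis .
qed

lemma of_real_of_bool: "of_real (of_bool P) = (of_bool P :: 'a :: real_algebra_1)"
  by (cases P) auto

text \<open>By linearity a single cell can be treated at a time; its contribution factors into a row
  and a column generating function.\<close>

lemma entry_prob_generating_function:
  fixes w w' :: complex
  assumes p: "0 \<le> p" "p \<le> 1" and X: "X \<in> carrier_mat m m"
  shows "(\<Sum>i<m. \<Sum>j<m. of_real (entry_prob p X i j) * w ^ i * w' ^ j) =
    of_real (1 - p) ^ 2 * (\<Sum>r<m. \<Sum>s<m. of_bool (X $$ (r, s)) *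
      (of_real p + of_real (1 - p) * w) ^ r * (of_real p + of_real (1 - p) * w') ^ s)"
proof -
  let ?u = "\<lambda>i r. complex_of_real (line_prob p m i r)"
  have "(\<Sum>i<m. \<Sum>j<m. of_real (entry_prob p X i j) * w ^ i * w' ^ j) =
     (\<Sum>i<m. \<Sum>j<m. \<Sum>r<m. \<Sum>s<m. of_bool (X $$ (r, s)) * ((?u i r * w ^ i) * (?u j s * w' ^ j)))"
    by (simp add: entry_prob_conv_line_prob[OF X] sum_distrib_left sum_distrib_right mult_ac of_real_of_bool
             del: sum_of_bool_mult_eq sum_mult_of_bool_eq)
  \<comment> \<open>Four exchanges bring \<open>r\<close> and \<open>s\<close> outermost, after
    which the sums over \<open>i\<close> and \<open>j\<close> separate.\<close>
  also have "\<dots> = (\<Sum>i<m. \<Sum>r<m. \<Sum>j<m. \<Sum>s<m. of_bool (X $$ (r, s)) * ((?u i r * w ^ i) * (?u j s * w' ^ j)))"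
    by (intro sum.cong refl sum.swap)
  also have "\<dots> = (\<Sum>r<m. \<Sum>i<m. \<Sum>j<m. \<Sum>s<m. of_bool (X $$ (r, s)) * ((?u i r * w ^ i) * (?u j s * w' ^ j)))"
    by (rule sum.swap)
  also have "\<dots> = (\<Sum>r<m. \<Sum>i<m. \<Sum>s<m. \<Sum>j<m. of_bool (X $$ (r, s)) * ((?u i r * w ^ i) * (?u j s * w' ^ j)))"
    by (intro sum.cong refl sum.swap)
  also have "\<dots> = (\<Sum>r<m. \<Sum>s<m. \<Sum>i<m. \<Sum>j<m. of_bool (X $$ (r, s)) * ((?u i r * w ^ i) * (?u j s * w' ^ j)))"
    by (intro sum.cong refl sum.swap)
  also have "\<dots> = (\<Sum>r<m. \<Sum>s<m. of_bool (X $$ (r, s)) * ((\<Sum>i<m. ?u i r * w ^ i) * (\<Sum>j<m. ?u j s * w' ^ j)))"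
    by (intro sum.cong refl) (simp only: sum_product, simp only: sum_distrib_left)
  also have "\<dots> = (\<Sum>r<m. \<Sum>s<m. of_bool (X $$ (r, s)) *
      ((of_real (1 - p) * (of_real p + of_real (1 - p) * w) ^ r) *
       (of_real (1 - p) * (of_real p + of_real (1 - p) * w') ^ s)))"
    by (intro sum.cong refl) (simp only: line_prob_generating_function[OF p] lessThan_iff)
  also have "\<dots> = of_real (1 - p) ^ 2 * (\<Sum>r<m. \<Sum>s<m. of_bool (X $$ (r, s)) *
      (of_real p + of_real (1 - p) * w) ^ r * (of_real p + of_real (1 - p) * w') ^ s)"
    by (simp only: sum_distrib_left power2_eq_square mult_ac)
  finally show ?thesis .
qed

section \<open>Statistics of independent traces\<close>

lemma replicate_pmf_map: "replicate_pmf n (map_pmf f M) = map_pmf (map f) (replicate_pmf n M)"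
  by (induction n) (simp_all add: map_bind_pmf bind_map_pmf)

text \<open>The number of samples satisfying \<open>P\<close> is binomial, so this is Hoeffding's
  inequality.\<close>

lemma prob_replicate_pmf_frequency:
  assumes T: "T > 0" and \<epsilon>: "\<epsilon> \<ge> 0"
  shows "measure_pmf.prob (replicate_pmf T M)
     {xs. \<bar>real (length (filter P xs)) / real T - measure_pmf.prob M {x. P x}\<bar> \<ge> \<epsilon>} \<le> 2 * exp (- 2 * real T * \<epsilon>\<^sup>2)"
proof -
  define \<mu> where "\<mu> = measure_pmf.prob M {x. P x}"
  have \<mu>: "\<mu> \<in> {0..1}" by (simp add: \<mu>_def)
  have bern: "map_pmf P M = bernoulli_pmf \<mu>"
  proof (rule pmf_eqI)
    fix b
    have "measure_pmf.prob M {x. \<not> P x} = 1 - \<mu>"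
      unfolding \<mu>_def by (subst measure_pmf.prob_compl[symmetric]) (auto simp: Compl_eq[symmetric] set_diff_eq)
    thus "pmf (map_pmf P M) b = pmf (bernoulli_pmf \<mu>) b"
      using \<mu> by (cases b) (auto simp: pmf_map vimage_def \<mu>_def)
  qed
  have "map_pmf (\<lambda>xs. length (filter P xs)) (replicate_pmf T M) =
        map_pmf (length \<circ> filter id) (replicate_pmf T (map_pmf P M))"
    by (simp add: replicate_pmf_map pmf.map_comp o_def filter_map id_def)
  also have "\<dots> = binomial_pmf T \<mu>"
    by (simp add: bern binomial_pmf_altdef[OF \<mu>])
  finally have *: "binomial_pmf T \<mu> = map_pmf (\<lambda>xs. length (filter P xs)) (replicate_pmf T M)" ..
  interpret binomial_distribution T \<mu> by unfold_locales (rule \<mu>)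
  show ?thesis
    using prob_abs_ge'[OF T \<epsilon>] unfolding * \<mu>_def[symmetric] by (simp add: vimage_def)
qed

lemma prob_replicate_pmf_avoid:
  "measure_pmf.prob (replicate_pmf T M) {xs. \<forall>x\<in>set xs. x \<notin> E} = (1 - measure_pmf.prob M E) ^ T"
proof (induction T)
  case (Suc T)
  have compl: "measure_pmf.prob M (- E) = 1 - measure_pmf.prob M E"
    using measure_pmf.prob_compl[of E M] by (simp add: Compl_eq_Diff_UNIV)
  have "replicate_pmf (Suc T) M = map_pmf (\<lambda>(x, xs). x # xs) (pair_pmf M (replicate_pmf T M))"
    by (simp add: pair_pmf_def map_bind_pmf)
  moreover have "(\<lambda>(x, xs). x # xs) -` {xs. \<forall>x\<in>set xs. x \<notin> E} = (- E) \<times> {xs. \<forall>x\<in>set xs. x \<notin> E}"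
    by auto
  ultimately have "measure_pmf.prob (replicate_pmf (Suc T) M) {xs. \<forall>x\<in>set xs. x \<notin> E} =
      measure_pmf.prob (pair_pmf M (replicate_pmf T M)) ((- E) \<times> {xs. \<forall>x\<in>set xs. x \<notin> E})"
    by simp
  also have "\<dots> = measure_pmf.prob M (- E) * measure_pmf.prob (replicate_pmf T M) {xs. \<forall>x\<in>set xs. x \<notin> E}"
    by (rule prob_pair_pmf_Times)
  finally show ?case by (simp add: compl Suc.IH)
qed simp

section \<open>Traces without deletions\<close>

lemma submatrix_lessThan:
  assumes X: "X \<in> carrier_mat m m"
  shows "submatrix X {..<m} {..<m} = X"
proof -
  have dims: "dim_row X = m" "dim_col X = m" using X by auto
  show ?thesis
  proof (rule eq_matI)
    have c: "{i. i < m \<and> i \<in> {..<m}} = {..<m}" by auto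
    fix i j assume ij: "i < dim_row X" "j < dim_col X"
    have "pick {..<m} i = i" if "i < m" for i
    proof -
      have "{a \<in> {..<m}. a < i} = {..<i}" using that by auto
      thus ?thesis using pick_card_in_set[of i "{..<m}"] that by simp
    qed
    thus "submatrix X {..<m} {..<m} $$ (i, j) = X $$ (i, j)"
      using ij by (simp add: submatrix_def dims c)
  qed (auto simp: submatrix_def dims)
qed

lemma prob_full_trace:
  assumes p: "0 \<le> p" "p \<le> 1" and X: "X \<in> carrier_mat m m"
  shows "measure_pmf.prob (matrix_deletion_channel p X) {X} \<ge> (1 - p) ^ (2 * m)"
proof -
  have full: "pmf (survivors p k) {..<k} = (1 - p) ^ k" for k
  proof (induction k)
    case (Suc k)
    have R: "R \<subseteq> {..<k}" if "R \<in> set_pmf (survivors p k)" for R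
      using that set_pmf_survivors by blast
    have ins: "insert k R = {..<Suc k} \<longleftrightarrow> R = {..<k}" if "R \<in> set_pmf (survivors p k)" for R
      using R[OF that] insert_ident[of k R "{..<k}"] by (auto simp: lessThan_Suc)
    have "pmf (survivors p (Suc k)) {..<Suc k} =
      (1 - p) * pmf (map_pmf (insert k) (survivors p k)) {..<Suc k} + p * pmf (survivors p k) {..<Suc k}"
      using p by (simp add: survivors_Suc pmf_bind)
    also have "pmf (map_pmf (insert k) (survivors p k)) {..<Suc k} = measure_pmf.prob (survivors p k) {{..<k}}"
      unfolding pmf_map by (intro measure_pmf.finite_measure_eq_AE AE_pmfI) (simp_all add: ins)
    also have "pmf (survivors p k) {..<Suc k} = 0"
      using R[of "{..<Suc k}"] by (auto simp: pmf_eq_0_set_pmf)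
    finally show ?case by (simp add: Suc measure_pmf_single)
  qed (simp add: survivors_0)
  have dims: "dim_row X = m" "dim_col X = m" using X by auto
  have "(1 - p) ^ (2 * m) = pmf (pair_pmf (survivors p m) (survivors p m)) ({..<m}, {..<m})"
    by (simp add: pmf_pair full power_add mult_2)
  also have "\<dots> \<le> measure_pmf.prob (pair_pmf (survivors p m) (survivors p m)) ((\<lambda>(R, S). submatrix X R S) -` {X})"
    unfolding measure_pmf_single[symmetric] by (intro measure_pmf.finite_measure_mono) (auto simp: submatrix_lessThan[OF X])
  finally show ?thesis
    by (simp add: matrix_deletion_channel_altdef dims)
qed

section \<open>Reconstruction\<close>

text \<open>The solution \<open>w\<close> of \<open>p + (1 - p) * w = cis \<theta>\<close> satisfies
  \<open>|w|^2 = 1 + 2 p (1 - cos \<theta>) / (1 - p)^2\<close>, so its modulus exceeds 1 only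
  quadratically in the angle:
  \<open>2 (1 - cos \<theta>) = 4 sin (\<theta> / 2)^2 <= t^2\<close>.\<close>

lemma norm_unscaled_arc_point_le:
  assumes p: "0 \<le> p" "p < 1" and \<theta>: "\<bar>\<theta>\<bar> \<le> t"
  shows "norm ((cis \<theta> - of_real p) / of_real (1 - p)) \<le> exp (p * t\<^sup>2 / (2 * (1 - p)\<^sup>2))"
proof (rule power2_le_imp_le)
  let ?q = "1 - p"
  have q: "?q > 0" using p by simp
  have "\<bar>sin (\<theta> / 2)\<bar> \<le> t / 2"
    using abs_sin_x_le_abs_x[of "\<theta> / 2"] \<theta> by simp
  hence "(sin (\<theta> / 2))\<^sup>2 \<le> (t / 2)\<^sup>2"
    by (metis abs_ge_zero power2_abs power_mono)
  hence cos: "2 * (1 - cos \<theta>) \<le> t\<^sup>2"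
    using cos_double_sin[of "\<theta> / 2"] by (simp add: power_divide)
  have "(norm ((cis \<theta> - of_real p) / of_real ?q))\<^sup>2 = ((cos \<theta> - p)\<^sup>2 + (sin \<theta>)\<^sup>2) / ?q\<^sup>2"
    unfolding norm_divide power_divide by (simp add: cmod_power2 norm_of_real del: of_real_diff)
  also have "(cos \<theta> - p)\<^sup>2 + (sin \<theta>)\<^sup>2 = ?q\<^sup>2 + p * (2 * (1 - cos \<theta>))"
    using sin_cos_squared_add[of \<theta>] by (simp add: power2_eq_square algebra_simps)
  also have "(?q\<^sup>2 + p * (2 * (1 - cos \<theta>))) / ?q\<^sup>2 = 1 + p * (2 * (1 - cos \<theta>)) / ?q\<^sup>2"
    using q by (simp add: field_simps)
  also have "\<dots> \<le> 1 + p * t\<^sup>2 / ?q\<^sup>2"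
    using cos p by (intro add_left_mono divide_right_mono mult_left_mono) auto
  also have "\<dots> \<le> exp (p * t\<^sup>2 / ?q\<^sup>2)"
    by (rule exp_ge_add_one_self)
  also have "\<dots> = (exp (p * t\<^sup>2 / (2 * ?q\<^sup>2)))\<^sup>2"
    by (simp flip: exp_double)
  finally show "(norm ((cis \<theta> - of_real p) / of_real ?q))\<^sup>2 \<le> (exp (p * t\<^sup>2 / (2 * ?q\<^sup>2)))\<^sup>2" .
qed simp

text \<open>If all entry probabilities are close, the polynomial of the difference of
  \<open>X\<close> and \<open>Y\<close> is small on the arc, while
  \<open>bivariate_littlewood_arc\<close> limits how small it can be. The additional factor
  \<open>m^2\<close> counts the positions \<open>(i, j)\<close>.\<close>

lemma entry_prob_separation:
  assumes p: "0 \<le> p" "p < 1" and L: "L > 0"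
    and X: "X \<in> carrier_mat m m" and Y: "Y \<in> carrier_mat m m" and ne: "X \<noteq> Y"
    and close: "\<And>i j. i < m \<Longrightarrow> j < m \<Longrightarrow> \<bar>entry_prob p X i j - entry_prob p Y i j\<bar> \<le> \<eta>"
  shows "(1 - p)\<^sup>2 \<le> \<eta> * real m ^ (2 * L\<^sup>2 + 2) * exp (real m * p * pi\<^sup>2 / ((real L)\<^sup>2 * (1 - p)\<^sup>2))"
proof -
  let ?q = "1 - p"
  have q: "?q > 0" using p by simp
  define d :: "nat \<Rightarrow> nat \<Rightarrow> complex" where "d = (\<lambda>r s. of_bool (X $$ (r, s)) - of_bool (Y $$ (r, s)))"
  \<comment> \<open>\<open>E\<close> bounds the preimages \<open>w\<close> and \<open>w'\<close> of
    arc points, so each monomial in them is at most \<open>E ^ m * E ^ m\<close>.\<close>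
  define E where "E = exp (p * (pi / real L)\<^sup>2 / (2 * ?q\<^sup>2))"
  have E1: "1 \<le> E" using p by (simp add: E_def)
  have E2: "E ^ m * E ^ m = exp (real m * p * pi\<^sup>2 / ((real L)\<^sup>2 * ?q\<^sup>2))"
    unfolding E_def exp_of_nat_mult[symmetric] exp_add[symmetric] using L q
    by (simp add: power_divide field_simps)
  have "\<exists>r<m. \<exists>s<m. X $$ (r, s) \<noteq> Y $$ (r, s)"
  proof (rule ccontr)
    assume "\<not> ?thesis"
    hence "X = Y" using X Y by (intro eq_matI) auto
    thus False using ne by simp
  qed
  then obtain r s where rs: "r < m" "s < m" "X $$ (r, s) \<noteq> Y $$ (r, s)"
    by blast
  have \<eta>0: "\<eta> \<ge> 0"
    using order_trans[OF abs_ge_zero close[OF rs(1,2)]] .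
  have "1 \<le> (\<eta> * (real m)\<^sup>2 * (E ^ m * E ^ m) / ?q\<^sup>2) * real m ^ (2 * L\<^sup>2)"
  proof (rule bivariate_littlewood_arc[OF L])
    show "\<exists>r<m. \<exists>s<m. d r s \<noteq> 0"
      using rs by (auto simp: d_def)
    show "norm (d r s) = 1" if "d r s \<noteq> 0" for r s
      using that by (auto simp: d_def of_bool_def split: if_splits)
    fix \<theta> \<phi> :: real assume \<theta>: "\<bar>\<theta>\<bar> \<le> pi / real L" and \<phi>: "\<bar>\<phi>\<bar> \<le> pi / real L"
    define w where "w = (cis \<theta> - of_real p) / of_real ?q"
    define w' where "w' = (cis \<phi> - of_real p) / of_real ?q"
    have w: "of_real p + of_real ?q * w = cis \<theta>" "of_real p + of_real ?q * w' = cis \<phi>"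
      using q by (simp_all add: w_def w'_def del: of_real_diff)
    have nw: "norm w \<le> E" "norm w' \<le> E"
      unfolding w_def w'_def E_def by (rule norm_unscaled_arc_point_le[OF p]; fact)+
    have pw: "norm w ^ i \<le> E ^ m" "norm w' ^ i \<le> E ^ m" if "i < m" for i
      using power_mono[OF nw(1), of i] power_mono[OF nw(2), of i] power_increasing[of i m E] E1 that
      by simp_all
    \<comment> \<open>The generating function is linear in the matrix, so the polynomial with
      coefficients \<open>d\<close> on the arc is recovered from differences of entry
      probabilities.\<close>
    have "of_real ?q ^ 2 * (\<Sum>r<m. \<Sum>s<m. d r s * cis \<theta> ^ r * cis \<phi> ^ s) =
       (\<Sum>i<m. \<Sum>j<m. of_real (entry_prob p X i j) * w ^ i * w' ^ j) -
       (\<Sum>i<m. \<Sum>j<m. of_real (entry_prob p Y i j) * w ^ i * w' ^ j)"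
      using p by (simp only: entry_prob_generating_function[OF p(1) less_imp_le[OF p(2)]] X Y w d_def
          left_diff_distrib sum_subtractf right_diff_distrib)
    also have "\<dots> = (\<Sum>i<m. \<Sum>j<m. of_real (entry_prob p X i j - entry_prob p Y i j) * w ^ i * w' ^ j)"
      by (simp only: left_diff_distrib sum_subtractf of_real_diff)
    also have "norm \<dots> \<le> (\<Sum>i<m. \<Sum>j<m. \<eta> * (E ^ m * E ^ m))"
      using close pw \<eta>0 E1
      by (intro sum_norm_le) (auto simp: norm_mult norm_power mult.assoc simp del: of_real_diff intro!: mult_mono)
    finally have "?q\<^sup>2 * norm (\<Sum>r<m. \<Sum>s<m. d r s * cis \<theta> ^ r * cis \<phi> ^ s) \<le> \<eta> * (real m)\<^sup>2 * (E ^ m * E ^ m)"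
      by (simp add: norm_mult norm_power norm_of_real power2_eq_square mult_ac del: of_real_diff)
    thus "norm (\<Sum>r<m. \<Sum>s<m. d r s * cis \<theta> ^ r * cis \<phi> ^ s) \<le> \<eta> * (real m)\<^sup>2 * (E ^ m * E ^ m) / ?q\<^sup>2"
      using q by (simp add: pos_le_divide_eq mult.commute)
  qed
  hence "1 \<le> \<eta> * real m ^ (2 * L\<^sup>2 + 2) * exp (real m * p * pi\<^sup>2 / ((real L)\<^sup>2 * ?q\<^sup>2)) / ?q\<^sup>2"
    unfolding E2 power_add by (simp only: mult_ac times_divide_eq_left times_divide_eq_right)
  thus ?thesis using q by (simp add: le_divide_eq)
qed

section \<open>Reconstruction from empirical frequencies\<close>

lemma exp_minus_le_inverse: "exp (- x) \<le> 1 / x" if "x > 0" for x :: real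
proof -
  have "x \<le> exp x" using exp_ge_add_one_self[of x] by linarith
  thus ?thesis using that by (simp add: exp_minus field_simps)
qed

text \<open>Frequencies within \<open>\<eta> / 2\<close> of the truth at every position identify the
  matrix, by the triangle inequality and \<open>sep\<close>. A failure probability of
  \<open>1 / m^3\<close> per position, summed over \<open>m^2\<close> positions, gives
  \<open>1 / m\<close>.\<close>

lemma reconstruct_from_entry_frequencies:
  assumes m: "m > 0" and \<eta>: "\<eta> > 0" and T: "real T \<ge> 4 * real m ^ 3 / \<eta>\<^sup>2"
    and sep: "\<And>X Y. X \<in> carrier_mat m m \<Longrightarrow> Y \<in> carrier_mat m m \<Longrightarrow>
      (\<And>i j. i < m \<Longrightarrow> j < m \<Longrightarrow> \<bar>entry_prob p X i j - entry_prob p Y i j\<bar> \<le> \<eta>) \<Longrightarrow> X = Y"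
  shows "\<exists>reconstruct :: bool mat list \<Rightarrow> bool mat. \<forall>X \<in> carrier_mat m m.
    measure_pmf.prob (matrix_traces T p X) {traces. reconstruct traces = X} \<ge> 1 - 1 / real m"
proof -
  define freq :: "bool mat list \<Rightarrow> nat \<Rightarrow> nat \<Rightarrow> real" where
    "freq = (\<lambda>ts i j. real (length (filter (\<lambda>Z. i < dim_row Z \<and> j < dim_col Z \<and> Z $$ (i, j)) ts)) / real T)"
  define good where
    "good = (\<lambda>ts X. X \<in> carrier_mat m m \<and> (\<forall>i<m. \<forall>j<m. \<bar>freq ts i j - entry_prob p X i j\<bar> < \<eta> / 2))"
  have unique: "X = Y" if g: "good ts X" "good ts Y" for ts X Y
  proof (rule sep)
    fix i j assume "i < m" "j < m"
    hence "\<bar>freq ts i j - entry_prob p X i j\<bar> < \<eta> / 2" "\<bar>freq ts i j - entry_prob p Y i j\<bar> < \<eta> / 2"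
      using g by (auto simp: good_def)
    thus "\<bar>entry_prob p X i j - entry_prob p Y i j\<bar> \<le> \<eta>" by linarith
  qed (use g in \<open>auto simp: good_def\<close>)
  have T\<eta>: "4 * real m ^ 3 \<le> real T * \<eta>\<^sup>2"
    using T \<eta> by (simp add: field_simps)
  hence T0: "T > 0" using m \<eta> by (cases "T = 0") auto
  have "1 - 1 / real m \<le> measure_pmf.prob (matrix_traces T p X) {ts. (THE Y. good ts Y) = X}"
    if X: "X \<in> carrier_mat m m" for X
  proof -
    let ?M = "matrix_traces T p X"
    let ?bad = "\<lambda>i j. {ts. \<bar>freq ts i j - entry_prob p X i j\<bar> \<ge> \<eta> / 2}"
    have bad: "measure_pmf.prob ?M (?bad i j) \<le> 1 / real m ^ 3" for i j
    proof -
      have "measure_pmf.prob ?M (?bad i j) \<le> 2 * exp (- 2 * real T * (\<eta> / 2)\<^sup>2)"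
        unfolding matrix_traces_def freq_def entry_prob_def
        by (rule prob_replicate_pmf_frequency) (use T0 \<eta> in auto)
      also have "- 2 * real T * (\<eta> / 2)\<^sup>2 = - (real T * \<eta>\<^sup>2 / 2)"
        by (simp add: power_divide)
      \<comment> \<open>Polynomial decay suffices, so the exponential is weakened to a reciprocal;
        this is the origin of the requirement \<open>T >= 4 m^3 / \<eta>^2\<close>.\<close>
      also have "2 * exp (- (real T * \<eta>\<^sup>2 / 2)) \<le> 2 * (1 / (real T * \<eta>\<^sup>2 / 2))"
        using T0 \<eta> by (intro mult_left_mono exp_minus_le_inverse) auto
      also have "\<dots> = 4 / (real T * \<eta>\<^sup>2)" by simp
      also have "\<dots> \<le> 4 / (4 * real m ^ 3)"
        using T\<eta> m by (intro divide_left_mono) (auto intro!: mult_pos_pos T0 \<eta>)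
      finally show ?thesis by simp
    qed
    have "measure_pmf.prob ?M (- {ts. (THE Y. good ts Y) = X}) \<le>
          measure_pmf.prob ?M (\<Union>ij\<in>{..<m} \<times> {..<m}. ?bad (fst ij) (snd ij))"
    proof (intro measure_pmf.finite_measure_mono subsetI)
      fix ts assume "ts \<in> - {ts. (THE Y. good ts Y) = X}"
      \<comment> \<open>By uniqueness \<open>THE\<close> returns \<open>X\<close> as soon as
        \<open>X\<close> is good, so a failure puts some position out of tolerance.\<close>
      hence "\<not> good ts X" using the_equality[of "good ts" X] unique by blast
      thus "ts \<in> (\<Union>ij\<in>{..<m} \<times> {..<m}. ?bad (fst ij) (snd ij))"
        using X by (force simp: good_def not_less)
    qed auto
    also have "\<dots> \<le> (\<Sum>ij\<in>{..<m} \<times> {..<m}. measure_pmf.prob ?M (?bad (fst ij) (snd ij)))"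
      by (rule measure_pmf.finite_measure_subadditive_finite) auto
    also have "\<dots> \<le> (\<Sum>ij\<in>{..<m} \<times> {..<m}. 1 / real m ^ 3)"
      by (intro sum_mono bad)
    also have "\<dots> = 1 / real m"
      using m by (simp add: power3_eq_cube)
    finally show ?thesis
      using measure_pmf.prob_compl[of "{ts. (THE Y. good ts Y) = X}" ?M] by (simp add: Compl_eq_Diff_UNIV)
  qed
  thus ?thesis by (intro exI[of _ "\<lambda>ts. THE Y. good ts Y"]) blast
qed

section \<open>Reconstruction from a trace of full size\<close>

lemma full_trace_eq:
  assumes X: "X \<in> carrier_mat m m" and Z: "Z \<in> set_pmf (matrix_deletion_channel p X)" "Z \<in> carrier_mat m m"
  shows "Z = X"
proof -
  have dims: "dim_row X = m" "dim_col X = m" using X by auto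
  obtain R S where RS: "R \<subseteq> {..<m}" "S \<subseteq> {..<m}" and Z_eq: "Z = submatrix X R S"
  proof -
    obtain R S where "R \<in> set_pmf (survivors p m)" "S \<in> set_pmf (survivors p m)" "Z = submatrix X R S"
      using Z(1) by (auto simp: matrix_deletion_channel_altdef dims)
    thus ?thesis using set_pmf_survivors that by blast
  qed
  have "{i. i < m \<and> i \<in> R} = R" "{i. i < m \<and> i \<in> S} = S" using RS by auto
  hence "dim_row Z = card R" "dim_col Z = card S" by (simp_all add: Z_eq submatrix_def dims)
  hence "card R = card {..<m}" "card S = card {..<m}" using Z(2) by auto
  hence "R = {..<m}" "S = {..<m}" using RS card_subset_eq[of "{..<m}"] by simp_all
  thus ?thesis using submatrix_lessThan[OF X] Z_eq by simp
qed

text \<open>An \<open>m\<close> by \<open>m\<close> trace has lost no line and hence equals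
  \<open>X\<close>, so it can be recognised from its dimensions alone. Failure requires that all
  \<open>T\<close> independent traces differ from \<open>X\<close>.\<close>

lemma reconstruct_from_full_trace:
  assumes p: "0 \<le> p" "p \<le> 1"
  shows "\<exists>reconstruct :: bool mat list \<Rightarrow> bool mat. \<forall>X \<in> carrier_mat m m.
    measure_pmf.prob (matrix_traces T p X) {traces. reconstruct traces = X} \<ge> 1 - (1 - (1 - p) ^ (2 * m)) ^ T"
proof -
  define rec where "rec = (\<lambda>ts :: bool mat list. SOME Z. Z \<in> set ts \<and> Z \<in> carrier_mat m m)"
  have "1 - (1 - (1 - p) ^ (2 * m)) ^ T \<le> measure_pmf.prob (matrix_traces T p X) {ts. rec ts = X}"
    if X: "X \<in> carrier_mat m m" for X
  proof -
    let ?D = "matrix_deletion_channel p X"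
    have "(1 - measure_pmf.prob ?D {X}) ^ T \<le> (1 - (1 - p) ^ (2 * m)) ^ T"
      using prob_full_trace[OF p X] by (intro power_mono) auto
    moreover have "measure_pmf.prob (matrix_traces T p X) (- {ts. rec ts = X}) \<le>
        measure_pmf.prob (replicate_pmf T ?D) {ts. \<forall>Z\<in>set ts. Z \<notin> {X}}"
      unfolding matrix_traces_def
    proof (intro measure_pmf.finite_measure_mono_AE AE_pmfI impI)
      fix ts assume "ts \<in> set_pmf (replicate_pmf T ?D)" and bad: "ts \<in> - {ts. rec ts = X}"
      hence ts: "set ts \<subseteq> set_pmf ?D" by (auto simp: set_replicate_pmf)
      have "X \<notin> set ts"
      proof
        assume "X \<in> set ts"
        hence "rec ts \<in> set ts \<and> rec ts \<in> carrier_mat m m"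
          unfolding rec_def using X by (intro someI[of "\<lambda>Z. Z \<in> set ts \<and> Z \<in> carrier_mat m m" X] conjI)
        hence "rec ts = X" using full_trace_eq[OF X] ts by blast
        thus False using bad by simp
      qed
      thus "ts \<in> {ts. \<forall>Z\<in>set ts. Z \<notin> {X}}" by auto
    qed auto
    ultimately have "measure_pmf.prob (matrix_traces T p X) (- {ts. rec ts = X}) \<le> (1 - (1 - p) ^ (2 * m)) ^ T"
      by (simp only: prob_replicate_pmf_avoid)
    thus ?thesis
      using measure_pmf.prob_compl[of "{ts. rec ts = X}" "matrix_traces T p X"] by (simp add: Compl_eq_Diff_UNIV)
  qed
  thus ?thesis by blast
qed

section \<open>Number of traces in the two regimes\<close>

lemma ln_ge_1: "ln (real m) \<ge> 1" if "m \<ge> 3"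
proof -
  have "exp 1 \<le> real m" using that exp_le by linarith
  thus ?thesis using that by (simp add: ln_ge_iff)
qed

text \<open>The separation loses \<open>exp (2 L^2 l)\<close> from the arc and
  \<open>exp (pi^2 A^2 l / L^2)\<close> from the moduli of \<open>w\<close> and \<open>w'\<close>;
  for \<open>L^2\<close> near \<open>A\<close> both exponents are of order \<open>A * l = B\<close>.
  The hypothesis \<open>mp\<close> gives \<open>A >= 1\<close>, so rounding \<open>L\<close> to an
  integer costs only a constant factor.\<close>

lemma traces_suffice_many_deletions:
  assumes p: "0 \<le> p" "p < 1" and m: "m \<ge> 3" and mp: "ln (real m) \<le> real m * p"
  shows "\<exists>T. real T \<le> exp (51 * (sqrt (real m * p * ln (real m)) / (1 - p))) \<and>
    (\<exists>reconstruct :: bool mat list \<Rightarrow> bool mat. \<forall>X \<in> carrier_mat m m.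
      measure_pmf.prob (matrix_traces T p X) {traces. reconstruct traces = X} \<ge> 1 - 1 / real m)"
proof -
  define q where "q = 1 - p"
  define l where "l = ln (real m)"
  define A where "A = sqrt (real m * p / l) / q"
  define B where "B = sqrt (real m * p * l) / q"
  have q: "0 < q" "q \<le> 1" using p by (auto simp: q_def)
  have l: "l \<ge> 1" using ln_ge_1[OF m] by (simp add: l_def)
  have mp0: "real m * p \<ge> 0" using p by simp
  have A1: "A \<ge> 1"
  proof -
    have "1 \<le> real m * p / l" using mp l by (simp add: l_def[symmetric])
    hence "1 \<le> sqrt (real m * p / l)" by simp
    hence "q \<le> sqrt (real m * p / l)" using q by linarith
    thus ?thesis using q by (simp add: A_def)
  qed
  have sql: "l = sqrt l * sqrt l" using l by simp
  have AB: "A * l = B"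
  proof -
    have "sqrt (real m * p / l) * l = sqrt (real m * p * l)"
      using l by (simp add: real_sqrt_divide real_sqrt_mult field_simps flip: sql)
    thus ?thesis by (simp add: A_def B_def)
  qed
  have A2: "A\<^sup>2 * l = real m * p / q\<^sup>2"
    using l mp0 by (simp add: A_def power_divide)
  have lB: "l \<le> B" using A1 l by (simp flip: AB)
  \<comment> \<open>The factor \<open>1 / q^2\<close> in \<open>1 / \<eta>\<close> must also be
    absorbed into \<open>exp (O(B))\<close>; this works because
    \<open>m p l >= l^2 >= 1\<close>.\<close>
  have qB: "1 / q \<le> B"
  proof -
    have "1 \<le> l * l" using mult_mono[of 1 l 1 l] l by simp
    also have "l * l \<le> real m * p * l" using mp l by (intro mult_right_mono) (auto simp: l_def)
    finally have "1 \<le> sqrt (real m * p * l)" by simp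
    thus ?thesis using q by (simp add: B_def divide_right_mono)
  qed
  have qexp: "1 / q \<le> exp B"
    using qB exp_ge_add_one_self[of B] by linarith
  define L where "L = nat \<lceil>sqrt A\<rceil>"
  have sA: "sqrt A \<ge> 1" using A1 by simp
  have L_ge: "sqrt A \<le> real L" unfolding L_def by linarith
  have L0: "L > 0" using L_ge sA by (cases "L = 0") auto
  have L2_ge: "A \<le> (real L)\<^sup>2"
    using power_mono[OF L_ge, of 2] A1 by simp
  have "real L \<le> 2 * sqrt A" unfolding L_def using sA by linarith
  hence "(real L)\<^sup>2 \<le> (2 * sqrt A)\<^sup>2" by (intro power_mono) auto
  hence L2_le: "(real L)\<^sup>2 \<le> 4 * A" using A1 by (simp add: power_mult_distrib)
  \<comment> \<open>The exponent of \<open>m\<close> is one larger than in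
    \<open>entry_prob_separation\<close>; the additional factor \<open>m > 1\<close> turns the weak
    inequality there into a contradiction.\<close>
  define N where "N = real m ^ (2 * L\<^sup>2 + 3) * exp (real m * p * pi\<^sup>2 / ((real L)\<^sup>2 * q\<^sup>2))"
  define \<eta> where "\<eta> = q\<^sup>2 / N"
  have N0: "N > 0" using m by (simp add: N_def)
  have \<eta>0: "\<eta> > 0" using N0 q by (simp add: \<eta>_def)
  have sep: "X = Y" if XY: "X \<in> carrier_mat m m" "Y \<in> carrier_mat m m"
    "\<And>i j. i < m \<Longrightarrow> j < m \<Longrightarrow> \<bar>entry_prob p X i j - entry_prob p Y i j\<bar> \<le> \<eta>" for X Y
  proof (rule ccontr)
    assume "X \<noteq> Y"
    from entry_prob_separation[OF p L0 XY(1,2) this XY(3)]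
    have "q\<^sup>2 \<le> \<eta> * (real m ^ (2 * L\<^sup>2 + 2) * exp (real m * p * pi\<^sup>2 / ((real L)\<^sup>2 * q\<^sup>2)))"
      by (simp add: q_def mult.assoc)
    hence "q\<^sup>2 * real m \<le> (\<eta> * (real m ^ (2 * L\<^sup>2 + 2) * exp (real m * p * pi\<^sup>2 / ((real L)\<^sup>2 * q\<^sup>2)))) * real m"
      by (rule mult_right_mono) simp
    also have "\<dots> = \<eta> * N" by (simp add: N_def power_add power3_eq_cube power2_eq_square mult_ac)
    also have "\<dots> = q\<^sup>2" using N0 by (simp add: \<eta>_def)
    finally show False using q m by simp
  qed
  have mexp: "real m ^ k = exp (real k * l)" for k
    using m by (simp add: l_def exp_of_nat_mult)
  \<comment> \<open>Here \<open>21 = 8 + 3 + 10\<close>: \<open>L^2 <= 4 A\<close> gives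
    \<open>2 L^2 l <= 8 B\<close>, \<open>l <= B\<close> gives \<open>3 l <= 3 B\<close>, and
    \<open>pi^2 <= 10\<close> with \<open>L^2 >= A\<close> bounds the other exponent.\<close>
  have N_le: "N \<le> exp (21 * B)"
  proof -
    have "real (2 * L\<^sup>2 + 3) * l \<le> (8 * A + 3) * l"
      using L2_le l by (intro mult_right_mono) auto
    also have "\<dots> \<le> 11 * B" using lB AB by (simp add: distrib_right)
    finally have 1: "real (2 * L\<^sup>2 + 3) * l \<le> 11 * B" .
    have "pi\<^sup>2 \<le> (3.15)\<^sup>2" using pi_approx by (intro power_mono) auto
    hence pi10: "pi\<^sup>2 \<le> 10" by (simp add: power2_eq_square)
    have "real m * p * pi\<^sup>2 / ((real L)\<^sup>2 * q\<^sup>2) = (real m * p / q\<^sup>2) * pi\<^sup>2 / (real L)\<^sup>2"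
      by (simp add: field_simps)
    also have "\<dots> = A\<^sup>2 * l * pi\<^sup>2 / (real L)\<^sup>2" by (simp add: A2)
    also have "\<dots> \<le> A\<^sup>2 * l * 10 / A"
      using pi10 L2_ge A1 l L0 by (intro frac_le mult_left_mono) auto
    also have "\<dots> = 10 * B" using A1 by (simp add: AB[symmetric] power2_eq_square)
    finally have 2: "real m * p * pi\<^sup>2 / ((real L)\<^sup>2 * q\<^sup>2) \<le> 10 * B" .
    have "N = exp (real (2 * L\<^sup>2 + 3) * l + real m * p * pi\<^sup>2 / ((real L)\<^sup>2 * q\<^sup>2))"
      by (simp only: N_def mexp exp_add)
    also have "\<dots> \<le> exp (21 * B)" using 1 2 by simp
    finally show ?thesis .
  qed
  have inv_le: "1 / \<eta> \<le> exp (23 * B)"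
  proof -
    have "1 / \<eta> = N * ((1 / q) * (1 / q))" by (simp add: \<eta>_def power2_eq_square)
    also have "\<dots> \<le> exp (21 * B) * (exp B * exp B)"
      using N_le qexp q N0 by (intro mult_mono) auto
    also have "\<dots> = exp (23 * B)" by (simp flip: exp_add)
    finally show ?thesis .
  qed
  define T where "T = nat \<lceil>4 * real m ^ 3 / \<eta>\<^sup>2\<rceil>"
  have T_ge: "real T \<ge> 4 * real m ^ 3 / \<eta>\<^sup>2" unfolding T_def by linarith
  \<comment> \<open>Here \<open>51 = 5 + 2 * 23\<close>: rounding up gives at most
    \<open>5 m^3 / \<eta>^2\<close>, the factor 5 is below \<open>m^2\<close>, and
    \<open>m^5 <= exp (5 B)\<close>.\<close>
  have T_le: "real T \<le> exp (51 * B)"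
  proof -
    have \<eta>1: "\<eta> \<le> 1"
    proof -
      have "q\<^sup>2 \<le> 1" using q by (simp add: power_le_one)
      also have "1 \<le> N" unfolding N_def using m p
        by (intro mult_ge1_I one_le_power) auto
      finally show ?thesis using N0 by (simp add: \<eta>_def)
    qed
    have m9: "9 \<le> real m ^ 2" using power_mono[of 3 "real m" 2] m by simp
    have "1 \<le> real m ^ 3 / \<eta>\<^sup>2"
      using \<eta>0 \<eta>1 m by (simp add: power_le_one one_le_power order_trans[of _ 1])
    hence "real T \<le> 5 * (real m ^ 3 / \<eta>\<^sup>2)" unfolding T_def by linarith
    also have "\<dots> \<le> real m ^ 2 * (real m ^ 3 / \<eta>\<^sup>2)"
      using m9 \<eta>0 by (intro mult_right_mono) auto
    also have "\<dots> = real m ^ 5 * ((1 / \<eta>) * (1 / \<eta>))"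
      by (simp add: power2_eq_square power_numeral_reduce)
    also have "\<dots> \<le> exp (5 * B) * (exp (23 * B) * exp (23 * B))"
      using inv_le \<eta>0 lB unfolding mexp by (intro mult_mono) auto
    also have "\<dots> = exp (51 * B)" by (simp flip: exp_add)
    finally show ?thesis .
  qed
  have "\<exists>reconstruct :: bool mat list \<Rightarrow> bool mat. \<forall>X \<in> carrier_mat m m.
      measure_pmf.prob (matrix_traces T p X) {traces. reconstruct traces = X} \<ge> 1 - 1 / real m"
    using m by (intro reconstruct_from_entry_frequencies[OF _ \<eta>0 T_ge sep]) auto
  thus ?thesis using T_le unfolding B_def l_def q_def by blast
qed

text \<open>A trace is complete with probability at least \<open>exp (- 4 * lam)\<close>, and
  \<open>lam < l\<close> gives \<open>lam <= B\<close>, so the allowed number of traces outweighs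
  this loss when \<open>B\<close> is large. For tiny \<open>lam\<close> a single trace is already
  complete with probability close to 1. Cutting at \<open>lam = 1 / sqrt l\<close> bounds the
  failure by \<open>4 / l^(1/4)\<close> on both sides.\<close>

lemma traces_suffice_few_deletions:
  assumes p: "0 \<le> p" "p < 1" and m: "m \<ge> 3" and mp: "real m * p < ln (real m)"
  shows "\<exists>T. real T \<le> exp (51 * (sqrt (real m * p * ln (real m)) / (1 - p))) \<and>
    (\<exists>reconstruct :: bool mat list \<Rightarrow> bool mat. \<forall>X \<in> carrier_mat m m.
      measure_pmf.prob (matrix_traces T p X) {traces. reconstruct traces = X} \<ge>
        1 - 4 / sqrt (sqrt (ln (real m))))"
proof -
  define l where "l = ln (real m)"
  define lam where "lam = real m * p"
  define B where "B = sqrt (lam * l)"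
  define T where "T = nat \<lfloor>exp (51 * (B / (1 - p)))\<rfloor>"
  define a where "a = (1 - p) ^ (2 * m)"
  have l: "l \<ge> 1" using ln_ge_1[OF m] by (simp add: l_def)
  have lam: "0 \<le> lam" "lam < l" using p mp by (auto simp: lam_def l_def)
  have B0: "B \<ge> 0" using lam l by (simp add: B_def)
  have lamB: "lam \<le> B"
    unfolding B_def using lam by (intro real_le_rsqrt) (auto simp: power2_eq_square intro: mult_left_mono)
  \<comment> \<open>\<open>m p < ln m <= m / 2\<close>, the latter from
    \<open>(sqrt m - 2)^2 >= 0\<close>. The bound on \<open>p\<close> then yields
    \<open>ln (1 - p) >= - 2 p\<close>.\<close>
  have p_half: "p \<le> 1 / 2"
  proof -
    have "ln (real m) = 2 * ln (sqrt (real m))" using m by (simp add: ln_sqrt)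
    also have "\<dots> \<le> 2 * (sqrt (real m) - 1)"
      using m by (intro mult_left_mono ln_le_minus_one) auto
    also have "\<dots> \<le> real m / 2"
      using zero_le_power2[of "sqrt (real m) - 2"] by (simp add: power2_eq_square algebra_simps)
    finally have "real m * p < real m * (1 / 2)" using mp by simp
    thus ?thesis using m by simp
  qed
  have "p * p \<le> p * (1 / 2)" using p p_half by (intro mult_left_mono) auto
  hence "- 2 * p \<le> ln (1 - p)"
    using ln_one_minus_pos_lower_bound[OF p(1) p_half] by (simp add: power2_eq_square)
  hence "exp (- 2 * p) \<le> 1 - p" using p by (simp add: ln_ge_iff)
  hence "exp (- 2 * p) ^ (2 * m) \<le> a" unfolding a_def by (intro power_mono) auto
  hence a_ge: "exp (- 4 * lam) \<le> a"
    by (simp add: lam_def exp_of_nat_mult[symmetric] mult_ac)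
  have a01: "0 < a" "a \<le> 1" using p by (auto simp: a_def power_le_one)
  have T_le: "real T \<le> exp (51 * (B / (1 - p)))" unfolding T_def by simp
  have "0 \<le> B / (1 - p)" using B0 p by simp
  hence "1 \<le> exp (51 * (B / (1 - p)))" by simp
  \<comment> \<open>Rounding down a number that is at least 1 loses at most half of it.\<close>
  hence T1: "T \<ge> 1" and T_ge: "real T \<ge> exp (51 * (B / (1 - p))) / 2"
  proof -
    have "1 \<le> real (nat \<lfloor>z\<rfloor>) \<and> z < real (nat \<lfloor>z\<rfloor>) + 1" if "1 \<le> z" for z :: real
    proof -
      have "real (nat \<lfloor>z\<rfloor>) = of_int \<lfloor>z\<rfloor>" "1 \<le> \<lfloor>z\<rfloor>" using that by (simp_all add: le_floor_iff)
      thus ?thesis using real_of_int_floor_add_one_gt[of z] by linarith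
    qed
    from this[OF \<open>1 \<le> exp _\<close>] have "1 \<le> real T" "exp (51 * (B / (1 - p))) < real T + 1"
      unfolding T_def by blast+
    thus "T \<ge> 1" "real T \<ge> exp (51 * (B / (1 - p))) / 2" by linarith+
  qed
  have s: "1 \<le> sqrt l" "1 \<le> sqrt (sqrt l)" "sqrt (sqrt l) \<le> sqrt l"
    using l by (auto intro!: real_le_lsqrt simp: power2_eq_square) 
  have fail: "(1 - a) ^ T \<le> 4 / sqrt (sqrt l)"
  proof (cases "lam \<le> 1 / sqrt l")
    case True
    have "(1 - a) ^ T \<le> (1 - a) ^ 1"
      using a01 T1 by (intro power_decreasing) auto
    also have "\<dots> \<le> 4 * lam" using a_ge exp_ge_add_one_self[of "- 4 * lam"] by simp
    also have "\<dots> \<le> 4 / sqrt l" using True by simp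
    also have "\<dots> \<le> 4 / sqrt (sqrt l)" using s by (intro divide_left_mono) auto
    finally show ?thesis .
  next
    case False
    have "sqrt l = 1 / sqrt l * l" using l by (simp add: field_simps)
    also have "\<dots> \<le> lam * l" using False l by (intro mult_right_mono) auto
    finally have B_ge: "sqrt (sqrt l) \<le> B" unfolding B_def by simp
    have Bq: "B \<le> B / (1 - p)" using B0 p by (simp add: le_divide_eq mult_left_le)
    have "B \<le> exp B" using exp_ge_add_one_self[of B] by linarith
    \<comment> \<open>It is enough that \<open>4 * lam + B <= 5 * B <= 51 * (B / (1 - p))\<close>;
      the constant 51 comes from the other regime.\<close>
    also have "\<dots> \<le> exp (- 4 * lam + 51 * (B / (1 - p)))" using lamB Bq B0 by simp
    also have "\<dots> = 2 * (exp (- 4 * lam) * (exp (51 * (B / (1 - p))) / 2))" unfolding exp_add by simp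
    also have "\<dots> \<le> 2 * (a * real T)"
      using a_ge T_ge a01 by (intro mult_left_mono mult_mono) auto
    finally have aT: "B / 2 \<le> a * real T" by simp
    have Bpos: "B > 0" using B_ge s by linarith
    have "(1 - a) ^ T \<le> exp (- a) ^ T"
      using a01 exp_ge_add_one_self[of "- a"] by (intro power_mono) auto
    also have "\<dots> = exp (- (a * real T))" by (simp add: exp_of_nat_mult[symmetric] mult.commute)
    also have "\<dots> \<le> exp (- (B / 2))" using aT by simp
    also have "\<dots> \<le> 1 / (B / 2)" using Bpos by (intro exp_minus_le_inverse) simp
    also have "\<dots> \<le> 4 / sqrt (sqrt l)"
      using B_ge s Bpos by (simp add: frac_le)
    finally show ?thesis .
  qed
  obtain rec :: "bool mat list \<Rightarrow> bool mat" where rec: "\<And>X. X \<in> carrier_mat m m \<Longrightarrow>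
      measure_pmf.prob (matrix_traces T p X) {traces. rec traces = X} \<ge> 1 - (1 - a) ^ T"
    using reconstruct_from_full_trace[OF p(1) less_imp_le[OF p(2)], of m T] unfolding a_def by blast
  have "\<forall>X \<in> carrier_mat m m.
      measure_pmf.prob (matrix_traces T p X) {traces. rec traces = X} \<ge> 1 - 4 / sqrt (sqrt l)"
    using rec fail by (smt (verit))
  thus ?thesis using T_le unfolding B_def lam_def l_def by blast
qed

text \<open>\<open>C\<close> and \<open>\<delta>\<close> are chosen before \<open>p\<close>, so the
  bound is uniform in \<open>p\<close>, which may vary with \<open>n\<close>. The two regimes are
  divided at \<open>m p = ln m\<close>.\<close>

theorem theorem4:
  shows "\<exists>C > 0. \<exists>\<delta> :: nat \<Rightarrow> real. \<delta> \<longlonglongrightarrow> 0 \<and>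
    (\<forall>(p :: real) (q :: real) (n :: nat) (m :: nat).
       0 \<le> p \<longrightarrow> p < 1 \<longrightarrow> q = 1 - p \<longrightarrow> real m = sqrt (real n) \<longrightarrow>
       (\<exists>T :: nat.
          real T \<le> exp (C * (real n powr (1 / 4) * sqrt (p * ln (real n)) / q)) \<and>
          (\<exists>reconstruct :: bool mat list \<Rightarrow> bool mat.
             \<forall>X \<in> carrier_mat m m.
               measure_pmf.prob (matrix_traces T p X) {traces. reconstruct traces = X} \<ge> 1 - \<delta> n)))"
proof -
  \<comment> \<open>The summands are the failure bounds of the two regimes. For
    \<open>n < 9\<close>, where \<open>m < 3\<close>, the value 1 makes the claim hold with no
    traces at all.\<close>
  define \<delta> :: "nat \<Rightarrow> real" where
    "\<delta> = (\<lambda>n. if n < 9 then 1 else 1 / sqrt (real n) + 4 / sqrt (sqrt (ln (sqrt (real n)))))"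
  have "(\<lambda>n::nat. 1 / sqrt (real n) + 4 / sqrt (sqrt (ln (sqrt (real n))))) \<longlonglongrightarrow> 0"
    by real_asymp
  moreover have "\<forall>\<^sub>F n in sequentially. 1 / sqrt (real n) + 4 / sqrt (sqrt (ln (sqrt (real n)))) = \<delta> n"
    using eventually_ge_at_top[of 9] by eventually_elim (simp add: \<delta>_def)
  ultimately have \<delta>: "\<delta> \<longlonglongrightarrow> 0"
    by (rule Lim_transform_eventually)
  have main: "\<exists>T. real T \<le> exp (51 * (real n powr (1 / 4) * sqrt (p * ln (real n)) / q)) \<and>
          (\<exists>reconstruct :: bool mat list \<Rightarrow> bool mat. \<forall>X \<in> carrier_mat m m.
               measure_pmf.prob (matrix_traces T p X) {traces. reconstruct traces = X} \<ge> 1 - \<delta> n)"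
    if p: "0 \<le> p" "p < 1" and q: "q = 1 - p" and mn: "real m = sqrt (real n)" for p q :: real and n m :: nat
  proof (cases "n < 9")
    case True
    hence "\<delta> n = 1" by (simp add: \<delta>_def)
    thus ?thesis by (intro exI[of _ 0]) auto
  next
    case False
    hence "sqrt 9 \<le> sqrt (real n)" by (subst real_sqrt_le_iff) simp
    moreover have "sqrt 9 = (3 :: real)" by (rule real_sqrt_unique) auto
    ultimately have m: "m \<ge> 3" using mn by linarith
    have l: "ln (real m) \<ge> 1" by (rule ln_ge_1[OF m])
    have n: "real n = (real m)\<^sup>2" by (simp add: mn)
    have \<delta>n: "1 / real m \<le> \<delta> n" "4 / sqrt (sqrt (ln (real m))) \<le> \<delta> n"
      using False l m by (auto simp: \<delta>_def mn[symmetric])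
    \<comment> \<open>Since \<open>n = m^2\<close>, \<open>n powr (1 / 4) = sqrt m\<close> and
      \<open>ln n = 2 * ln m\<close>; the factor 2 only enlarges the allowance.\<close>
    have bound: "sqrt (real m * p * ln (real m)) / (1 - p) \<le> real n powr (1 / 4) * sqrt (p * ln (real n)) / q"
    proof -
      have "real n powr (1 / 4) = sqrt (real m)"
        unfolding n using m by (simp add: powr_half_sqrt[symmetric] powr_powr flip: powr_numeral)
      moreover have "p * ln (real n) = 2 * (p * ln (real m))"
        unfolding n using m by (simp add: ln_realpow)
      moreover have "real m * p * ln (real m) \<le> real m * (2 * (p * ln (real m)))"
        using p l by simp
      ultimately show ?thesis
        unfolding q using p by (auto simp flip: real_sqrt_mult intro!: divide_right_mono)
    qed
    hence exp_le: "exp (51 * (sqrt (real m * p * ln (real m)) / (1 - p))) \<le>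
        exp (51 * (real n powr (1 / 4) * sqrt (p * ln (real n)) / q))"
      by simp
    show ?thesis
    proof (cases "ln (real m) \<le> real m * p")
      case True
      then show ?thesis
        using traces_suffice_many_deletions[OF p m True] exp_le \<delta>n(1) by (smt (verit))
    next
      case False
      then show ?thesis
        using traces_suffice_few_deletions[OF p m] exp_le \<delta>n(2) by (smt (verit))
    qed
  qed
  show ?thesis
    by (rule exI[of _ 51], rule conjI[OF _ exI[of _ \<delta>]]) (use \<delta> main in auto)
qed

end
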